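(* Let $X$ be a non-trivial complex Banach space, let $1\le p<\infty$, let $I=\mathbb{R}$ or $I=[0,\infty)$, and let $f:I\to X$ and $g:I\to\mathbb{C}$ be bounded functions. (1) If $f\in Q_h\text{-}AAP(I:X)$ and $g\in Q\text{-}AAP(I:\mathbb{C})$, or $f\in Q\text{-}AAP(I:X)$ and $g\in Q_h\text{-}AAP(I:\mathbb{C})$, then $fg\in Q\text{-}AAP(I:X)$. (2) If $f\in S^pQ_h\text{-}AAP(I:X)$ and $g\in S^pQ\text{-}AAP(I:\mathbb{C})$, or $f\in S^pQ\text{-}AAP(I:X)$ and $g\in S^pQ_h\text{-}AAP(I:\mathbb{C})$, then $fg\in S^pQ\text{-}AAP(I:X)$.
   Context: Let $Z$ be a complex Banach space. $Q\text{-}AAP(I:Z)$ (quasi-asymptotically almost periodic functions) is the set of bounded continuous $f:I\to Z$ such that for each $\epsilon>0$ there exists a finite number $L(\epsilon)>0$ such that any interval $I'\subseteq I$ of length $L(\epsilon)$ contains at least one number $\tau\in I'$ for which there exists a finite number $M(\epsilon,\tau)>0$ such that (A) $\|f(t+\tau)-f(t)\|\le\epsilon$ for all $t\in I$ with $|t|\ge M(\epsilon,\tau)$. $S^pQ\text{-}AAP(I:Z)$ (Stepanov $p$-quasi-asymptotically almost periodic functions) is the set of $f\in L^p_{loc}(I:Z)$ with $\sup_{t\in I}\int_t^{t+1}\|f(s)\|^p\,ds<\infty$ such that for each $\epsilon>0$ there exists a finite number $L(\epsilon)>0$ such that any interval $I'\subseteq I$ of length $L(\epsilon)$ contains at least one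 number $\tau\in I'$ for which there exists a finite number $M(\epsilon,\tau)>0$ such that (B) $\int_t^{t+1}\|f(s+\tau)-f(s)\|^p\,ds\le\epsilon^p$ for all $t\in I$ with $|t|\ge M(\epsilon,\tau)$. $Q_h\text{-}AAP(I:Z)$ is the class of all $f\in Q\text{-}AAP(I:Z)$ such that for each $\epsilon>0$ and each $\tau\in I$ there exists a finite number $M(\epsilon,\tau)>0$ such that (A) holds. $S^pQ_h\text{-}AAP(I:Z)$ is the class of all $f\in S^pQ\text{-}AAP(I:Z)$ such that for each $\epsilon>0$ and each $\tau\in I$ there exists a finite number $M(\epsilon,\tau)>0$ such that (B) holds. *)

theory Defs
  imports "HOL-Analysis.Analysis"
begin

text \<open>
  A complex Banach space is a real Banach space with a complex scalar multiplication that
  extends the real one and for which the norm is homogeneous. (The unit law follows from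
  \<open>scaleC_of_real\<close>.)
\<close>

class complex_banach = banach +
  fixes scaleC :: "complex \<Rightarrow> 'a \<Rightarrow> 'a" (infixr "*\<^sub>C" 75)
  assumes scaleC_add_right: "c *\<^sub>C (x + y) = c *\<^sub>C x + c *\<^sub>C y"
    and scaleC_add_left: "(c + d) *\<^sub>C x = c *\<^sub>C x + d *\<^sub>C x"
    and scaleC_scaleC: "c *\<^sub>C d *\<^sub>C x = (c * d) *\<^sub>C x"
    and scaleC_of_real: "complex_of_real r *\<^sub>C x = r *\<^sub>R x"
    and norm_scaleC: "norm (c *\<^sub>C x) = cmod c * norm x"

instantiation complex :: complex_banach
begin

definition scaleC_complex :: "complex \<Rightarrow> complex \<Rightarrow> complex"
  where "scaleC_complex c z = c * z"

instance
  by standard (simp_all add: scaleC_complex_def algebra_simps scaleR_conv_of_real norm_mult)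

end

text \<open>
  A function on \<open>I\<close> is represented by a total function on the reals of which only the values
  on \<open>I\<close> matter.
\<close>

definition relatively_dense_in :: "real set \<Rightarrow> (real \<Rightarrow> bool) \<Rightarrow> bool" where
  "relatively_dense_in I P \<longleftrightarrow>
     (\<exists>L>0. \<forall>J. is_interval J \<and> J \<subseteq> I \<and> emeasure lborel J = ennreal L \<longrightarrow> (\<exists>\<tau>\<in>J. P \<tau>))"

definition asymp_period :: "real set \<Rightarrow> (real \<Rightarrow> 'a::complex_banach) \<Rightarrow> real \<Rightarrow> real \<Rightarrow> bool" where
  "asymp_period I f \<epsilon> \<tau> \<longleftrightarrow>
     (\<exists>M>0. \<forall>t\<in>I. \<bar>t\<bar> \<ge> M \<longrightarrow> norm (f (t + \<tau>) - f t) \<le> \<epsilon>)"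

definition Q_AAP :: "real set \<Rightarrow> (real \<Rightarrow> 'a::complex_banach) set" where
  "Q_AAP I = {f. bounded (f ` I) \<and> continuous_on I f \<and>
     (\<forall>\<epsilon>>0. relatively_dense_in I (asymp_period I f \<epsilon>))}"

definition Qh_AAP :: "real set \<Rightarrow> (real \<Rightarrow> 'a::complex_banach) set" where
  "Qh_AAP I = {f \<in> Q_AAP I. \<forall>\<epsilon>>0. \<forall>\<tau>\<in>I. asymp_period I f \<epsilon> \<tau>}"

text \<open>
  Strong (Bochner) measurability: almost everywhere limit of simple functions. For a
  non-separable codomain this is stronger than Borel measurability.
\<close>

definition strongly_measurable_on :: "real set \<Rightarrow> (real \<Rightarrow> 'a::complex_banach) \<Rightarrow> bool" where
  "strongly_measurable_on I f \<longleftrightarrow>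
     (\<exists>s. (\<forall>n::nat. simple_function (lebesgue_on I) (s n)) \<and>
          (AE t in lebesgue_on I. (\<lambda>n. s n t) \<longlonglongrightarrow> f t))"

definition Lp_loc :: "real \<Rightarrow> real set \<Rightarrow> (real \<Rightarrow> 'a::complex_banach) set" where
  "Lp_loc p I = {f. strongly_measurable_on I f \<and>
     (\<forall>K. compact K \<and> K \<subseteq> I \<longrightarrow> (\<integral>\<^sup>+ s\<in>K. ennreal (norm (f s) powr p) \<partial>lebesgue) < \<infinity>)}"

definition stepanov_asymp_period ::
    "real \<Rightarrow> real set \<Rightarrow> (real \<Rightarrow> 'a::complex_banach) \<Rightarrow> real \<Rightarrow> real \<Rightarrow> bool" where
  "stepanov_asymp_period p I f \<epsilon> \<tau> \<longleftrightarrow>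
     (\<exists>M>0. \<forall>t\<in>I. \<bar>t\<bar> \<ge> M \<longrightarrow>
        (\<integral>\<^sup>+ s\<in>{t..t+1}. ennreal (norm (f (s + \<tau>) - f s) powr p) \<partial>lebesgue) \<le> ennreal (\<epsilon> powr p))"

definition SpQ_AAP :: "real \<Rightarrow> real set \<Rightarrow> (real \<Rightarrow> 'a::complex_banach) set" where
  "SpQ_AAP p I = {f \<in> Lp_loc p I.
     (SUP t\<in>I. \<integral>\<^sup>+ s\<in>{t..t+1}. ennreal (norm (f s) powr p) \<partial>lebesgue) < \<infinity> \<and>
     (\<forall>\<epsilon>>0. relatively_dense_in I (stepanov_asymp_period p I f \<epsilon>))}"

definition SpQh_AAP :: "real \<Rightarrow> real set \<Rightarrow> (real \<Rightarrow> 'a::complex_banach) set" where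
  "SpQh_AAP p I = {f \<in> SpQ_AAP p I. \<forall>\<epsilon>>0. \<forall>\<tau>\<in>I. stepanov_asymp_period p I f \<epsilon> \<tau>}"

end

theory Submission
  imports Defs
begin

text \<open>
  Everything rests on
  \<open>g(t+\<tau>) f(t+\<tau>) - g(t) f(t) = g(t+\<tau>) (f(t+\<tau>) - f(t)) + (g(t+\<tau>) - g(t)) f(t)\<close>.
  If every \<open>\<tau>\<close> is an asymptotic \<open>\<delta>\<close>-period of one of the factors, then every asymptotic
  \<open>\<delta>\<close>-period \<open>\<tau>\<close> of the other factor is one of both simultaneously, and since \<open>f\<close> and \<open>g\<close> are
  bounded by some \<open>C\<close>, it is an asymptotic \<open>\<epsilon>\<close>-period of the product as soon as \<open>4 C \<delta> \<le> \<epsilon>\<close>.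
\<close>

section \<open>Complex scalar multiplication and the increment of a product\<close>

lemma bounded_bilinear_scaleC:
  "bounded_bilinear (scaleC :: complex \<Rightarrow> 'a::complex_banach \<Rightarrow> 'a)"
proof
  fix a a' :: complex and b b' :: 'a and r :: real
  show "(a + a') *\<^sub>C b = a *\<^sub>C b + a' *\<^sub>C b" by (rule scaleC_add_left)
  show "a *\<^sub>C (b + b') = a *\<^sub>C b + a *\<^sub>C b'" by (rule scaleC_add_right)
  \<comment> \<open>Homogeneity over the reals is obtained by reading \<open>r\<close> as a complex
    scalar through \<open>scaleC_of_real\<close> and regrouping with
    \<open>scaleC_scaleC\<close>.\<close>
  show "(r *\<^sub>R a) *\<^sub>C b = r *\<^sub>R (a *\<^sub>C b)"
    by (metis scaleC_of_real scaleC_scaleC scaleR_conv_of_real)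
  show "a *\<^sub>C (r *\<^sub>R b) = r *\<^sub>R (a *\<^sub>C b)"
    by (metis scaleC_of_real scaleC_scaleC mult.commute)
  show "\<exists>K. \<forall>a (b::'a). norm (a *\<^sub>C b) \<le> norm a * norm b * K"
    by (rule exI[of _ 1]) (simp add: norm_scaleC)
qed

text \<open>The test intervals are subsets of \<open>I\<close>, so only \<tau> in \<open>I\<close>
  have to be compared. This matters because the \<open>Qh\<close> classes supply periods only for
  \<tau> in \<open>I\<close>.\<close>

lemma relatively_dense_in_mono:
  assumes "relatively_dense_in I P" and "\<And>\<tau>. \<tau> \<in> I \<Longrightarrow> P \<tau> \<Longrightarrow> Q \<tau>"
  shows "relatively_dense_in I Q"
  using assms unfolding relatively_dense_in_def by (meson subset_iff)

lemma norm_scaleC_le: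
  assumes "cmod c \<le> C" "norm x \<le> D"
  shows "norm (c *\<^sub>C x) \<le> C * D"
  unfolding norm_scaleC by (rule mult_mono) (use assms norm_ge_zero order_trans in blast)+

text \<open>Meant for \<open>c\<close>, \<open>x\<close> taken at t + \<tau> and \<open>d\<close>,
  \<open>y\<close> at t. Inserting the mixed term \<open>c *\<^sub>C y\<close> leaves only
  \<open>c\<close> and \<open>y\<close> to be bounded, and one constant serves both.\<close>

lemma norm_scaleC_diff_le:
  fixes x y :: "'a::complex_banach"
  assumes "cmod c \<le> C" "norm y \<le> C"
  shows "norm (c *\<^sub>C x - d *\<^sub>C y) \<le> C * (norm (x - y) + cmod (c - d))"
proof -
  interpret bounded_bilinear "scaleC :: complex \<Rightarrow> 'a \<Rightarrow> 'a" by (rule bounded_bilinear_scaleC)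
  have "c *\<^sub>C x - d *\<^sub>C y = c *\<^sub>C (x - y) + (c - d) *\<^sub>C y"
    by (simp add: diff_left diff_right)
  then have "norm (c *\<^sub>C x - d *\<^sub>C y) \<le> norm (c *\<^sub>C (x - y)) + norm ((c - d) *\<^sub>C y)"
    by (simp add: norm_triangle_ineq)
  also have "\<dots> \<le> C * norm (x - y) + cmod (c - d) * C"
    by (intro add_mono norm_scaleC_le assms order_refl)
  finally show ?thesis by (simp add: algebra_simps)
qed

text \<open>Beyond the larger of the two thresholds each factor contributes an error of at most
  \<open>C * \<delta>\<close>, which gives the constant 2. The bound on \<open>g\<close> is used at
  t + \<tau>, which \<open>shift\<close> keeps in \<open>I\<close>.\<close>

lemma asymp_period_scaleC:
  assumes f: "asymp_period I f \<delta> \<tau>" and g: "asymp_period I g \<delta> \<tau>"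
    and shift: "\<And>t. t \<in> I \<Longrightarrow> t + \<tau> \<in> I"
    and bf: "\<And>t. t \<in> I \<Longrightarrow> norm (f t) \<le> C" and bg: "\<And>t. t \<in> I \<Longrightarrow> cmod (g t) \<le> C"
    and C: "0 < C"
  shows "asymp_period I (\<lambda>t. g t *\<^sub>C f t) (2 * C * \<delta>) \<tau>"
proof -
  obtain M where M: "M > 0" "\<And>t. t \<in> I \<Longrightarrow> \<bar>t\<bar> \<ge> M \<Longrightarrow> norm (f (t + \<tau>) - f t) \<le> \<delta>"
    using f unfolding asymp_period_def by blast
  obtain N where N: "N > 0" "\<And>t. t \<in> I \<Longrightarrow> \<bar>t\<bar> \<ge> N \<Longrightarrow> norm (g (t + \<tau>) - g t) \<le> \<delta>"
    using g unfolding asymp_period_def by blast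
  have "norm (g (t + \<tau>) *\<^sub>C f (t + \<tau>) - g t *\<^sub>C f t) \<le> 2 * C * \<delta>"
    if "t \<in> I" "\<bar>t\<bar> \<ge> max M N" for t
  proof -
    have "norm (g (t + \<tau>) *\<^sub>C f (t + \<tau>) - g t *\<^sub>C f t)
        \<le> C * (norm (f (t + \<tau>) - f t) + cmod (g (t + \<tau>) - g t))"
      using that by (intro norm_scaleC_diff_le bf bg shift) auto
    also have "\<dots> \<le> C * (\<delta> + \<delta>)"
      using that C by (intro mult_left_mono add_mono M N) auto
    finally show ?thesis by simp
  qed
  then show ?thesis
    unfolding asymp_period_def using M(1) by (intro exI[of _ "max M N"]) auto
qed

section \<open>Measurability: norms, combinations and translates\<close>

lemma lebesgue_borel_measurable_AE:
  fixes f g :: "real \<Rightarrow> real"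
  assumes f: "f \<in> borel_measurable lebesgue" and ae: "AE x in lebesgue. f x = g x"
  shows "g \<in> borel_measurable lebesgue"
proof (rule measurableI)
  fix A :: "real set" assume "A \<in> sets borel"
  then have "f -` A \<inter> space lebesgue \<in> sets lebesgue" by (rule measurable_sets[OF f])
  moreover have "AE x in lebesgue. x \<in> f -` A \<inter> space lebesgue \<longleftrightarrow> x \<in> g -` A \<inter> space lebesgue"
    using ae by eventually_elim auto
  \<comment> \<open>Completeness of Lebesgue measure: a set that agrees almost everywhere with a
    measurable set is measurable.\<close>
  ultimately show "g -` A \<inter> space lebesgue \<in> sets lebesgue"
    using completion.in_sets_AE[of "f -` A \<inter> space lebesgue" "g -` A \<inter> space lebesgue" lborel]
    by auto
qed simp

text \<open>The norms of the simple approximants are real-valued measurable functions, and they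
  converge almost everywhere to the norm of \<open>f\<close>. Extension by zero off \<open>I\<close>
  moves the statement to the whole line.\<close>

lemma strongly_measurable_on_norm:
  assumes f: "strongly_measurable_on I f" and I: "I \<in> sets lebesgue"
  shows "(\<lambda>t. if t \<in> I then norm (f t) else 0) \<in> borel_measurable lebesgue"
proof -
  obtain s where s: "\<And>n. simple_function (lebesgue_on I) (s n)"
    and lim: "AE t in lebesgue_on I. (\<lambda>n. s n t) \<longlonglongrightarrow> f t"
    using f unfolding strongly_measurable_on_def by blast
  let ?u = "\<lambda>n t. if t \<in> I then norm (s n t) else 0"
  have meas: "?u n \<in> borel_measurable lebesgue" for n
    by (intro borel_measurable_if_I[OF _ I] borel_measurable_simple_function
        simple_function_compose1[OF s])
  have lim: "AE t in lebesgue. t \<in> I \<longrightarrow> (\<lambda>n. s n t) \<longlonglongrightarrow> f t"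
    using lim I by (simp add: AE_restrict_space_iff)
  show ?thesis
  proof (rule lebesgue_borel_measurable_AE)
    \<comment> \<open>The function \<open>lim\<close> is measurable even though it takes an
      unspecified value where the sequence diverges; that happens only on a null set, so agreement
      almost everywhere suffices.\<close>
    show "(\<lambda>t. lim (\<lambda>n. ?u n t)) \<in> borel_measurable lebesgue"
      using meas by (rule borel_measurable_lim_metric)
    show "AE t in lebesgue. lim (\<lambda>n. ?u n t) = (if t \<in> I then norm (f t) else 0)"
      using lim by eventually_elim (auto intro!: limI tendsto_norm)
  qed
qed

text \<open>Combining two simple functions by any \<open>h\<close> gives a simple function, and
  sequential continuity of \<open>h\<close> carries the limits over. It serves subtraction (for
  increments) and \<open>scaleC\<close> (for the product).\<close>

lemma strongly_measurable_on_compose2: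
  assumes h: "\<And>u v x y. u \<longlonglongrightarrow> x \<Longrightarrow> v \<longlonglongrightarrow> y
        \<Longrightarrow> (\<lambda>n::nat. h (u n) (v n)) \<longlonglongrightarrow> h x y"
    and f: "strongly_measurable_on I f" and g: "strongly_measurable_on I g"
  shows "strongly_measurable_on I (\<lambda>t. h (f t) (g t))"
proof -
  obtain s where s: "\<And>n. simple_function (lebesgue_on I) (s n)"
    and s_lim: "AE t in lebesgue_on I. (\<lambda>n. s n t) \<longlonglongrightarrow> f t"
    using f unfolding strongly_measurable_on_def by blast
  obtain r where r: "\<And>n. simple_function (lebesgue_on I) (r n)"
    and r_lim: "AE t in lebesgue_on I. (\<lambda>n. r n t) \<longlonglongrightarrow> g t"
    using g unfolding strongly_measurable_on_def by blast
  have "AE t in lebesgue_on I. (\<lambda>n. h (s n t) (r n t)) \<longlonglongrightarrow> h (f t) (g t)"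
    using s_lim r_lim by eventually_elim (rule h)
  then show ?thesis
    unfolding strongly_measurable_on_def
    by (intro exI[of _ "\<lambda>n t. h (s n t) (r n t)"]) (auto intro: simple_function_compose2 s r)
qed

text \<open>The translated approximants work: translation is Lebesgue measurable, maps
  \<open>I\<close> into itself by \<open>shift\<close>, and preserves null sets.\<close>

lemma strongly_measurable_on_shift:
  assumes f: "strongly_measurable_on I f" and I: "I \<in> sets lebesgue"
    and shift: "\<And>t. t \<in> I \<Longrightarrow> t + \<tau> \<in> I"
  shows "strongly_measurable_on I (\<lambda>t. f (t + \<tau>))"
proof -
  obtain s where s: "\<And>n. simple_function (lebesgue_on I) (s n)"
    and lim: "AE t in lebesgue_on I. (\<lambda>n. s n t) \<longlonglongrightarrow> f t"
    using f unfolding strongly_measurable_on_def by blast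
  have meas: "(\<lambda>t. t + \<tau>) \<in> lebesgue \<rightarrow>\<^sub>M lebesgue"
    using lebesgue_affine_measurable[of "\<lambda>_. 1" \<tau>] by (simp add: add.commute)
  have meas_I: "(\<lambda>t. t + \<tau>) \<in> lebesgue_on I \<rightarrow>\<^sub>M lebesgue_on I"
    by (rule measurable_restrict_space3[OF meas]) (use shift in auto)
  have simple: "simple_function (lebesgue_on I) (\<lambda>t. s n (t + \<tau>))" for n
  proof (unfold simple_function_def, intro conjI ballI)
    show "finite ((\<lambda>t. s n (t + \<tau>)) ` space (lebesgue_on I))"
      by (rule finite_subset[OF _ simple_functionD(1)[OF s[of n]]])
        (use shift in \<open>auto simp: space_restrict_space\<close>)
    fix x
    show "(\<lambda>t. s n (t + \<tau>)) -` {x} \<inter> space (lebesgue_on I) \<in> sets (lebesgue_on I)"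
    proof -
      have "(\<lambda>t. t + \<tau>) -` (s n -` {x} \<inter> space (lebesgue_on I)) \<inter> space (lebesgue_on I)
          \<in> sets (lebesgue_on I)"
        by (rule measurable_sets[OF meas_I simple_functionD(2)[OF s]])
      also have "(\<lambda>t. t + \<tau>) -` (s n -` {x} \<inter> space (lebesgue_on I)) \<inter> space (lebesgue_on I)
          = (\<lambda>t. s n (t + \<tau>)) -` {x} \<inter> space (lebesgue_on I)"
        using shift by (auto simp: space_restrict_space)
      finally show ?thesis .
    qed
  qed
  \<comment> \<open>Translation invariance is available for negligible sets, so the
    almost-everywhere statement is recast as negligibility of its exceptional set.\<close>
  have "negligible {t. \<not> (t \<in> I \<longrightarrow> (\<lambda>n. s n t) \<longlonglongrightarrow> f t)}"
    using lim I by (simp add: AE_restrict_space_iff completion.AE_iff_null_sets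
        negligible_iff_null_sets)
  then have "negligible ((+) (-\<tau>) ` {t. \<not> (t \<in> I \<longrightarrow> (\<lambda>n. s n t) \<longlonglongrightarrow> f t)})"
    by (rule negligible_translation)
  \<comment> \<open>If t is exceptional for the translates, then t + \<tau> lies in \<open>I\<close>
    and is exceptional for the original sequence.\<close>
  moreover have "{t. \<not> (t \<in> I \<longrightarrow> (\<lambda>n. s n (t + \<tau>)) \<longlonglongrightarrow> f (t + \<tau>))}
      \<subseteq> (+) (-\<tau>) ` {t. \<not> (t \<in> I \<longrightarrow> (\<lambda>n. s n t) \<longlonglongrightarrow> f t)}"
    using shift by (auto intro!: image_eqI[where x = "_ + \<tau>"])
  ultimately have "negligible {t. \<not> (t \<in> I \<longrightarrow> (\<lambda>n. s n (t + \<tau>)) \<longlonglongrightarrow> f (t + \<tau>))}"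
    by (rule negligible_subset)
  then have "AE t in lebesgue_on I. (\<lambda>n. s n (t + \<tau>)) \<longlonglongrightarrow> f (t + \<tau>)"
    using I by (simp add: AE_restrict_space_iff completion.AE_iff_null_sets
        negligible_iff_null_sets)
  with simple show ?thesis
    unfolding strongly_measurable_on_def by (intro exI[of _ "\<lambda>n t. s n (t + \<tau>)"]) auto
qed

text \<open>On \<open>A\<close>, a subset of \<open>I\<close>, the norm agrees with its zero
  extension, and off \<open>A\<close> the indicator vanishes. The result supplies the measurability
  needed to split integrals of sums.\<close>

lemma strongly_measurable_on_set_borel_measurable:
  assumes f: "strongly_measurable_on I f" and I: "I \<in> sets lebesgue"
    and A: "A \<in> sets lebesgue" "A \<subseteq> I"
  shows "(\<lambda>t. ennreal (norm (f t) powr p) * indicator A t) \<in> borel_measurable lebesgue"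
proof -
  have "(\<lambda>t. ennreal ((if t \<in> I then norm (f t) else 0) powr p) * indicator A t)
      \<in> borel_measurable lebesgue"
    using strongly_measurable_on_norm[OF f I] A(1) by measurable
  also have "(\<lambda>t. ennreal ((if t \<in> I then norm (f t) else 0) powr p) * indicator A t)
      = (\<lambda>t. ennreal (norm (f t) powr p) * indicator A t)"
    using A(2) by (auto simp: fun_eq_iff indicator_def)
  finally show ?thesis .
qed

section \<open>The Stepanov estimate for a product\<close>

lemma powr_add_le:
  fixes a b p :: real
  assumes "0 \<le> a" "0 \<le> b" "0 \<le> p"
  shows "(a + b) powr p \<le> 2 powr p * (a powr p + b powr p)"
proof -
  \<comment> \<open>The sum is at most twice the larger term, whose power is one of the two summands
    on the right.\<close>
  have "(a + b) powr p \<le> (2 * max a b) powr p"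
    using assms by (intro powr_mono2) auto
  also have "\<dots> = 2 powr p * max a b powr p"
    using assms by (simp add: powr_mult)
  also have "\<dots> \<le> 2 powr p * (a powr p + b powr p)"
    by (intro mult_left_mono) (auto simp: max_def)
  finally show ?thesis .
qed

text \<open>The pointwise product estimate is raised to the power \<open>p\<close> and integrated
  over the unit window. Of the constant 4, one factor 2 comes from \<open>powr_add_le\<close> and
  the other absorbs the sum of the two errors \<open>\<delta> powr p\<close>.\<close>

lemma stepanov_asymp_period_scaleC:
  assumes f: "stepanov_asymp_period p I f \<delta> \<tau>" and g: "stepanov_asymp_period p I g \<delta> \<tau>"
    and mf: "strongly_measurable_on I f" and mg: "strongly_measurable_on I g"
    and I: "I \<in> sets lebesgue" "\<And>t. t \<in> I \<Longrightarrow> {t..t+1} \<subseteq> I"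
    and shift: "\<And>t. t \<in> I \<Longrightarrow> t + \<tau> \<in> I"
    and bf: "\<And>t. t \<in> I \<Longrightarrow> norm (f t) \<le> C" and bg: "\<And>t. t \<in> I \<Longrightarrow> cmod (g t) \<le> C"
    and pos: "0 < C" "0 < \<delta>" and p: "1 \<le> p"
  shows "stepanov_asymp_period p I (\<lambda>t. g t *\<^sub>C f t) (4 * C * \<delta>) \<tau>"
proof -
  let ?F = "\<lambda>s. norm (f (s + \<tau>) - f s) powr p" and ?G = "\<lambda>s. cmod (g (s + \<tau>) - g s) powr p"
  let ?H = "\<lambda>s. norm (g (s + \<tau>) *\<^sub>C f (s + \<tau>) - g s *\<^sub>C f s) powr p"
  define c where "c = C powr p * 2 powr p"
  obtain M where M: "M > 0"
    "\<And>t. t \<in> I \<Longrightarrow> \<bar>t\<bar> \<ge> M \<Longrightarrow> (\<integral>\<^sup>+ s\<in>{t..t+1}. ennreal (?F s) \<partial>lebesgue) \<le> ennreal (\<delta> powr p)"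
    using f unfolding stepanov_asymp_period_def by blast
  obtain N where N: "N > 0"
    "\<And>t. t \<in> I \<Longrightarrow> \<bar>t\<bar> \<ge> N \<Longrightarrow> (\<integral>\<^sup>+ s\<in>{t..t+1}. ennreal (?G s) \<partial>lebesgue) \<le> ennreal (\<delta> powr p)"
    using g unfolding stepanov_asymp_period_def by blast
  have c: "c * (\<delta> powr p + \<delta> powr p) \<le> (4 * C * \<delta>) powr p"
  proof -
    \<comment> \<open>Here \<open>1 \<le> p\<close> enters, through 2 \<le>
      \<open>2 powr p\<close>.\<close>
    have "2 * (C powr p * 2 powr p * \<delta> powr p) \<le> 2 powr p * (C powr p * 2 powr p * \<delta> powr p)"
      using powr_mono[of 1 p 2] p by (intro mult_right_mono) auto
    also have "\<dots> = (2 * (C * 2 * \<delta>)) powr p"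
      using pos by (simp only: powr_mult)
    finally show ?thesis by (simp add: c_def algebra_simps)
  qed
  have "(\<integral>\<^sup>+ s\<in>{t..t+1}. ennreal (?H s) \<partial>lebesgue) \<le> ennreal ((4 * C * \<delta>) powr p)"
    if t: "t \<in> I" "\<bar>t\<bar> \<ge> max M N" for t
  proof -
    have mF: "(\<lambda>s. ennreal (?F s) * indicator {t..t+1} s) \<in> borel_measurable lebesgue"
      by (rule strongly_measurable_on_set_borel_measurable[OF strongly_measurable_on_compose2[
            where h = minus, OF tendsto_diff strongly_measurable_on_shift[OF mf I(1) shift] mf]
          I(1) _ I(2)[OF t(1)]]) auto
    have mG: "(\<lambda>s. ennreal (?G s) * indicator {t..t+1} s) \<in> borel_measurable lebesgue"
      by (rule strongly_measurable_on_set_borel_measurable[OF strongly_measurable_on_compose2[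
            where h = minus, OF tendsto_diff strongly_measurable_on_shift[OF mg I(1) shift] mg]
          I(1) _ I(2)[OF t(1)]]) auto
    have "?H s \<le> c * (?F s + ?G s)" if "s \<in> {t..t+1}" for s
    proof -
      have s: "s \<in> I" using I(2)[OF t(1)] that by blast
      have "?H s \<le> (C * (norm (f (s + \<tau>) - f s) + cmod (g (s + \<tau>) - g s))) powr p"
        using p s by (intro powr_mono2 norm_scaleC_diff_le bf bg shift) auto
      also have "\<dots> = C powr p * (norm (f (s + \<tau>) - f s) + cmod (g (s + \<tau>) - g s)) powr p"
        using pos by (simp add: powr_mult)
      also have "\<dots> \<le> C powr p * (2 powr p * (?F s + ?G s))"
        using p by (intro mult_left_mono powr_add_le) auto
      finally show ?thesis by (simp add: c_def mult.assoc)
    qed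
    \<comment> \<open>Off the window both sides vanish, so the estimate holds for every real
      \<open>s\<close> and can be integrated.\<close>
    then have "ennreal (?H s) * indicator {t..t+1} s
        \<le> ennreal c * (ennreal (?F s) * indicator {t..t+1} s
                         + ennreal (?G s) * indicator {t..t+1} s)" for s
      by (auto simp: indicator_def c_def ennreal_leI simp flip: ennreal_plus ennreal_mult)
    then have "(\<integral>\<^sup>+ s\<in>{t..t+1}. ennreal (?H s) \<partial>lebesgue)
        \<le> (\<integral>\<^sup>+ s. ennreal c * (ennreal (?F s) * indicator {t..t+1} s
                         + ennreal (?G s) * indicator {t..t+1} s) \<partial>lebesgue)"
      by (intro nn_integral_mono)
    also have "\<dots> = ennreal c * ((\<integral>\<^sup>+ s\<in>{t..t+1}. ennreal (?F s) \<partial>lebesgue)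
                         + (\<integral>\<^sup>+ s\<in>{t..t+1}. ennreal (?G s) \<partial>lebesgue))"
      by (simp only: nn_integral_cmult[OF borel_measurable_add[OF mF mG]]
          nn_integral_add[OF mF mG])
    also have "\<dots> \<le> ennreal c * (ennreal (\<delta> powr p) + ennreal (\<delta> powr p))"
      using t by (intro mult_left_mono add_mono M N) auto
    also have "\<dots> = ennreal (c * (\<delta> powr p + \<delta> powr p))"
      by (simp add: c_def flip: ennreal_mult ennreal_plus)
    also have "\<dots> \<le> ennreal ((4 * C * \<delta>) powr p)"
      by (rule ennreal_leI[OF c])
    finally show ?thesis .
  qed
  then show ?thesis
    unfolding stepanov_asymp_period_def using M(1) by (intro exI[of _ "max M N"]) auto
qed

section \<open>Membership of the product in the two classes\<close>

lemma nn_integral_norm_powr_le: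
  assumes "\<And>t. t \<in> A \<Longrightarrow> norm (f t) \<le> C" and "A \<in> sets lebesgue" and "0 \<le> p"
  shows "(\<integral>\<^sup>+ s\<in>A. ennreal (norm (f s) powr p) \<partial>lebesgue) \<le> ennreal (C powr p) * emeasure lebesgue A"
proof -
  have "(\<integral>\<^sup>+ s\<in>A. ennreal (norm (f s) powr p) \<partial>lebesgue)
      \<le> (\<integral>\<^sup>+ s. ennreal (C powr p) * indicator A s \<partial>lebesgue)"
    using assms by (intro nn_integral_mono) (auto simp: indicator_def intro!: ennreal_leI powr_mono2)
  also have "\<dots> = ennreal (C powr p) * emeasure lebesgue A"
    by (rule nn_integral_cmult_indicator) fact
  finally show ?thesis .
qed

lemma Q_AAP_scaleC:
  assumes f: "f \<in> Q_AAP I" and g: "g \<in> Q_AAP I"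
    and h: "f \<in> Qh_AAP I \<or> g \<in> Qh_AAP I"
    and shift: "\<And>t \<tau>. t \<in> I \<Longrightarrow> \<tau> \<in> I \<Longrightarrow> t + \<tau> \<in> I"
    and bf: "\<And>t. t \<in> I \<Longrightarrow> norm (f t) \<le> C" and bg: "\<And>t. t \<in> I \<Longrightarrow> cmod (g t) \<le> C"
    and C: "0 < C"
  shows "(\<lambda>t. g t *\<^sub>C f t) \<in> Q_AAP I"
proof -
  have "bounded ((\<lambda>t. g t *\<^sub>C f t) ` I)"
    by (rule boundedI[where B = "C * C"]) (auto intro!: norm_scaleC_le bf bg)
  moreover have "continuous_on I (\<lambda>t. g t *\<^sub>C f t)"
    using f g by (auto simp: Q_AAP_def
        intro: bounded_bilinear.continuous_on[OF bounded_bilinear_scaleC])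
  moreover have "relatively_dense_in I (asymp_period I (\<lambda>t. g t *\<^sub>C f t) \<epsilon>)" if "\<epsilon> > 0" for \<epsilon>
  proof -
    \<comment> \<open>Chosen to cancel the factor \<open>2 * C\<close> lost in
      \<open>asymp_period_scaleC\<close>.\<close>
    define \<delta> where "\<delta> = \<epsilon> / (2 * C)"
    have \<delta>: "\<delta> > 0" "2 * C * \<delta> = \<epsilon>" using C that by (auto simp: \<delta>_def)
    have prod: "asymp_period I (\<lambda>t. g t *\<^sub>C f t) \<epsilon> \<tau>"
      if "\<tau> \<in> I" "asymp_period I f \<delta> \<tau>" "asymp_period I g \<delta> \<tau>" for \<tau>
      using asymp_period_scaleC[OF that(2,3) shift[OF _ that(1)] bf bg C] \<delta>(2) by simp
    have rf: "relatively_dense_in I (asymp_period I f \<delta>)"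
      and rg: "relatively_dense_in I (asymp_period I g \<delta>)"
      using f g \<delta>(1) by (auto simp: Q_AAP_def)
    from h show ?thesis
    proof
      assume "f \<in> Qh_AAP I"
      with \<delta>(1) show ?thesis
        \<comment> \<open>Relative density is taken from \<open>g\<close>; each of its
          \<delta>-periods in \<open>I\<close> is automatically one of \<open>f\<close>.\<close>
        by (intro relatively_dense_in_mono[OF rg] prod) (auto simp: Qh_AAP_def)
    next
      assume "g \<in> Qh_AAP I"
      with \<delta>(1) show ?thesis
        by (intro relatively_dense_in_mono[OF rf] prod) (auto simp: Qh_AAP_def)
    qed
  qed
  ultimately show ?thesis by (simp add: Q_AAP_def)
qed

lemma SpQ_AAP_scaleC:
  assumes f: "f \<in> SpQ_AAP p I" and g: "g \<in> SpQ_AAP p I"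
    and h: "f \<in> SpQh_AAP p I \<or> g \<in> SpQh_AAP p I"
    and I: "I \<in> sets lebesgue" "\<And>t. t \<in> I \<Longrightarrow> {t..t+1} \<subseteq> I"
    and shift: "\<And>t \<tau>. t \<in> I \<Longrightarrow> \<tau> \<in> I \<Longrightarrow> t + \<tau> \<in> I"
    and bf: "\<And>t. t \<in> I \<Longrightarrow> norm (f t) \<le> C" and bg: "\<And>t. t \<in> I \<Longrightarrow> cmod (g t) \<le> C"
    and C: "0 < C" and p: "1 \<le> p"
  shows "(\<lambda>t. g t *\<^sub>C f t) \<in> SpQ_AAP p I"
proof -
  have mf: "strongly_measurable_on I f" and mg: "strongly_measurable_on I g"
    using f g by (auto simp: SpQ_AAP_def Lp_loc_def)
  \<comment> \<open>A single bound for two uses: on compact sets it gives local integrability, on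
    unit windows the uniform Stepanov bound.\<close>
  have le: "(\<integral>\<^sup>+ s\<in>A. ennreal (norm (g s *\<^sub>C f s) powr p) \<partial>lebesgue)
      \<le> ennreal ((C * C) powr p) * emeasure lebesgue A"
    if "A \<subseteq> I" "A \<in> sets lebesgue" for A
    using that p by (intro nn_integral_norm_powr_le norm_scaleC_le bf bg) auto
  have "(\<integral>\<^sup>+ s\<in>K. ennreal (norm (g s *\<^sub>C f s) powr p) \<partial>lebesgue) < \<infinity>"
    if K: "compact K" "K \<subseteq> I" for K
  proof -
    have "K \<in> lmeasurable" using K(1) by (rule lmeasurable_compact)
    then have "K \<in> sets lebesgue" "emeasure lebesgue K < \<infinity>"
      by (auto simp: fmeasurable_def)
    then show ?thesis
      using le[OF K(2)] by (auto simp: ennreal_mult_less_top elim!: order_le_less_trans)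
  qed
  then have "(\<lambda>t. g t *\<^sub>C f t) \<in> Lp_loc p I"
    using strongly_measurable_on_compose2[where h = scaleC, OF
        bounded_bilinear.tendsto[OF bounded_bilinear_scaleC] mg mf]
    by (simp add: Lp_loc_def)
  moreover have "(SUP t\<in>I. \<integral>\<^sup>+ s\<in>{t..t+1}. ennreal (norm (g s *\<^sub>C f s) powr p) \<partial>lebesgue) < \<infinity>"
  proof -
    have "(SUP t\<in>I. \<integral>\<^sup>+ s\<in>{t..t+1}. ennreal (norm (g s *\<^sub>C f s) powr p) \<partial>lebesgue)
        \<le> ennreal ((C * C) powr p)"
      \<comment> \<open>A unit window has measure 1, so the bound does not depend on
        \<open>t\<close>.\<close>
      using le[OF I(2)] by (intro SUP_least) auto
    then show ?thesis by (auto elim!: order_le_less_trans)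
  qed
  moreover have "relatively_dense_in I (stepanov_asymp_period p I (\<lambda>t. g t *\<^sub>C f t) \<epsilon>)"
    if "\<epsilon> > 0" for \<epsilon>
  proof -
    \<comment> \<open>Matches the constant 4 of \<open>stepanov_asymp_period_scaleC\<close>.\<close>
    define \<delta> where "\<delta> = \<epsilon> / (4 * C)"
    have \<delta>: "\<delta> > 0" "4 * C * \<delta> = \<epsilon>" using C that by (auto simp: \<delta>_def)
    have prod: "stepanov_asymp_period p I (\<lambda>t. g t *\<^sub>C f t) \<epsilon> \<tau>"
      if "\<tau> \<in> I" "stepanov_asymp_period p I f \<delta> \<tau>" "stepanov_asymp_period p I g \<delta> \<tau>" for \<tau>
      using stepanov_asymp_period_scaleC[OF that(2,3) mf mg I shift[OF _ that(1)] bf bg C \<delta>(1) p]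
        \<delta>(2) by simp
    have rf: "relatively_dense_in I (stepanov_asymp_period p I f \<delta>)"
      and rg: "relatively_dense_in I (stepanov_asymp_period p I g \<delta>)"
      using f g \<delta>(1) by (auto simp: SpQ_AAP_def)
    from h show ?thesis
    proof
      assume "f \<in> SpQh_AAP p I"
      with \<delta>(1) show ?thesis
        by (intro relatively_dense_in_mono[OF rg] prod) (auto simp: SpQh_AAP_def)
    next
      assume "g \<in> SpQh_AAP p I"
      with \<delta>(1) show ?thesis
        by (intro relatively_dense_in_mono[OF rf] prod) (auto simp: SpQh_AAP_def)
    qed
  qed
  ultimately show ?thesis by (simp add: SpQ_AAP_def)
qed

theorem proposition2p15:
  fixes f :: "real \<Rightarrow> 'a::complex_banach"
    and g :: "real \<Rightarrow> complex"
    and p :: real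
    and I :: "real set"
  assumes nontrivial: "\<exists>x::'a. x \<noteq> 0"
    and p: "1 \<le> p"
    and I: "I = UNIV \<or> I = {0..}"
    and bounded_f: "bounded (f ` I)"
    and bounded_g: "bounded (g ` I)"
  shows "(f \<in> Qh_AAP I \<and> g \<in> Q_AAP I \<or> f \<in> Q_AAP I \<and> g \<in> Qh_AAP I
            \<longrightarrow> (\<lambda>t. g t *\<^sub>C f t) \<in> Q_AAP I) \<and>
         (f \<in> SpQh_AAP p I \<and> g \<in> SpQ_AAP p I \<or> f \<in> SpQ_AAP p I \<and> g \<in> SpQh_AAP p I
            \<longrightarrow> (\<lambda>t. g t *\<^sub>C f t) \<in> SpQ_AAP p I)"
proof -
  \<comment> \<open>Positive bounds are taken so that their maximum \<open>C\<close> can be divided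
    by when \<delta> is chosen.\<close>
  obtain A B where A: "A > 0" "\<And>t. t \<in> I \<Longrightarrow> norm (f t) \<le> A"
    and B: "B > 0" "\<And>t. t \<in> I \<Longrightarrow> cmod (g t) \<le> B"
    using bounded_f bounded_g unfolding bounded_pos by (metis imageI)
  define C where "C = max A B"
  have C: "0 < C" "\<And>t. t \<in> I \<Longrightarrow> norm (f t) \<le> C" "\<And>t. t \<in> I \<Longrightarrow> cmod (g t) \<le> C"
    using A B by (auto simp: C_def le_max_iff_disj)
  \<comment> \<open>The line and the half-line are both closed under addition, so shifts by \<tau>
    in \<open>I\<close> never leave the domain.\<close>
  have shift: "\<And>t \<tau>. t \<in> I \<Longrightarrow> \<tau> \<in> I \<Longrightarrow> t + \<tau> \<in> I"
    using I by auto
  have leb: "I \<in> sets lebesgue" and unit: "\<And>t. t \<in> I \<Longrightarrow> {t..t+1} \<subseteq> I"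
    using I by auto
  have "(\<lambda>t. g t *\<^sub>C f t) \<in> Q_AAP I"
    if "f \<in> Q_AAP I" "g \<in> Q_AAP I" "f \<in> Qh_AAP I \<or> g \<in> Qh_AAP I"
    by (rule Q_AAP_scaleC[OF that shift C(2,3,1)])
  moreover have "(\<lambda>t. g t *\<^sub>C f t) \<in> SpQ_AAP p I"
    if "f \<in> SpQ_AAP p I" "g \<in> SpQ_AAP p I" "f \<in> SpQh_AAP p I \<or> g \<in> SpQh_AAP p I"
    by (rule SpQ_AAP_scaleC[OF that leb unit shift C(2,3,1) p])
  \<comment> \<open>Each \<open>Qh\<close> class lies in its \<open>Q\<close> class, so either
    alternative means that both factors are in the \<open>Q\<close> class and at least one is in the
    \<open>Qh\<close> class.\<close>
  ultimately show ?thesis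
    unfolding Qh_AAP_def SpQh_AAP_def by blast
qed

end
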